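(* Let $X$ be an Archimedean partially ordered vector space with order unit $u$, and let $B\subseteq X$ be such that $B=Z(N(B))$. Then $B$ is a band in $X$ if and only if $N(B)$ is bisaturated in $\overline{\Lambda}$.
   Context: Let $X$ be a real vector space partially ordered by a cone $K$ (so $K$ is closed under addition and multiplication by nonnegative scalars, $K\cap(-K)=\{0\}$, and $x\le y$ iff $y-x\in K$). $X$ is Archimedean if $nx\le y$ for all $n\in\mathbb{N}$ implies $x\le 0$. An element $u\in K$ is an order unit if for each $x\in X$ there is $\alpha\ge 0$ with $-\alpha u\le x\le\alpha u$. Put $\|x\|_u=\inf\{\alpha>0\colon -\alpha u\le x\le \alpha u\}$, let $X'$ be the norm dual of $(X,\|\cdot\|_u)$ with its weak* topology, $K'=\{\varphi\in X'\colon \varphi(K)\subseteq[0,\infty)\}$, $\Sigma=\{\varphi\in K'\colon\varphi(u)=1\}$, $\Lambda$ the set of extreme points of $\Sigma$, and $\overline{\Lambda}$ the weak* closure of $\Lambda$ in $X'$. For $M\subseteq X$, $M^u$ is the set of upper bounds of $M$ in $X$. Elements $x,y\in X$ are disjoint, $x\perp y$, if $\{x+y,-x-y\}^u=\{x-y,-x+y\}^u$. The disjoint complement of $M\subseteq X$ is $M^d=\{y\in X\colon x\perp y\text{ for all }x\in M\}$. A linear subspace $B\subseteq X$ is a band if $(B^d)^d=B$. For $B\subseteq X$: $N(B)=\{\varphi\in\overline{\Lambda}\colon\varphi(b)=0\text{ for all }b\in B\}$. For $M\subseteq\overline{\Lambda}$: $Z(M)=\{x\in X\colon\varphi(x)=0\text{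 for all }\varphi\in M\}$. For a subset $M$ of a vector space, $\mathrm{aff}(M)$ is its affine hull (with $\mathrm{aff}(\emptyset)=\emptyset$). A subset $M\subseteq V:=\overline{\Lambda}$ is bisaturated (in $V$) if $$M=V\cap\overline{\mathrm{aff}\bigl(V\setminus(V\cap\overline{\mathrm{aff}(V\setminus M)})\bigr)},$$ closures being taken in $X'$ with the weak* topology. *)

theory Defs
  imports "HOL-Analysis.Analysis" "HOL-Library.Function_Algebras"
begin

text \<open>
  A vector space ordered by a cone is a type of class \<open>ordered_real_vector\<close>; the cone is
  \<open>{x. 0 \<le> x}\<close>. Functionals live in the function space \<open>'a \<Rightarrow> real\<close>, which is made a real vector
  space with pointwise operations so that \<open>affine hull\<close> and \<open>extreme_point_of\<close> apply to them.
\<close>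

instantiation "fun" :: (type, real_vector) real_vector
begin

definition scaleR_fun :: "real \<Rightarrow> ('a \<Rightarrow> 'b) \<Rightarrow> 'a \<Rightarrow> 'b"
  where "scaleR_fun c f = (\<lambda>x. c *\<^sub>R f x)"

instance
  by standard (simp_all add: scaleR_fun_def fun_eq_iff scaleR_add_right scaleR_add_left)

end

definition order_unit :: "'a::ordered_real_vector \<Rightarrow> bool"
  where "order_unit u \<longleftrightarrow>
    0 \<le> u \<and> (\<forall>x. \<exists>\<alpha>\<ge>0. - (\<alpha> *\<^sub>R u) \<le> x \<and> x \<le> \<alpha> *\<^sub>R u)"

definition unit_norm :: "'a::ordered_real_vector \<Rightarrow> 'a \<Rightarrow> real"
  where "unit_norm u x = Inf {\<alpha>. \<alpha> > 0 \<and> - (\<alpha> *\<^sub>R u) \<le> x \<and> x \<le> \<alpha> *\<^sub>R u}"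

definition norm_dual :: "'a::ordered_real_vector \<Rightarrow> ('a \<Rightarrow> real) set"
  where "norm_dual u = {\<phi>. linear \<phi> \<and> (\<exists>C. \<forall>x. \<bar>\<phi> x\<bar> \<le> C * unit_norm u x)}"

text \<open>The weak* topology is the topology of pointwise convergence on the norm dual.\<close>

definition weak_star :: "'a::ordered_real_vector \<Rightarrow> ('a \<Rightarrow> real) topology"
  where "weak_star u = subtopology (powertop_real UNIV) (norm_dual u)"

definition dual_cone :: "'a::ordered_real_vector \<Rightarrow> ('a \<Rightarrow> real) set"
  where "dual_cone u = {\<phi> \<in> norm_dual u. \<forall>x\<ge>0. 0 \<le> \<phi> x}"

definition state_space :: "'a::ordered_real_vector \<Rightarrow> ('a \<Rightarrow> real) set"
  where "state_space u = {\<phi> \<in> dual_cone u. \<phi> u = 1}"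

definition pure_states :: "'a::ordered_real_vector \<Rightarrow> ('a \<Rightarrow> real) set"
  where "pure_states u = {\<phi>. \<phi> extreme_point_of state_space u}"

definition pure_states_closure :: "'a::ordered_real_vector \<Rightarrow> ('a \<Rightarrow> real) set"
  where "pure_states_closure u = weak_star u closure_of pure_states u"

definition upper_bounds :: "'a::order set \<Rightarrow> 'a set"
  where "upper_bounds M = {z. \<forall>m\<in>M. m \<le> z}"

definition order_disjoint :: "'a::ordered_real_vector \<Rightarrow> 'a \<Rightarrow> bool"
  where "order_disjoint x y \<longleftrightarrow>
    upper_bounds {x + y, - x - y} = upper_bounds {x - y, - x + y}"

definition disjoint_complement :: "'a::ordered_real_vector set \<Rightarrow> 'a set"
  where "disjoint_complement M = {y. \<forall>x\<in>M. order_disjoint x y}"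

definition band :: "'a::ordered_real_vector set \<Rightarrow> bool"
  where "band B \<longleftrightarrow> subspace B \<and> disjoint_complement (disjoint_complement B) = B"

definition annihilator :: "'a::ordered_real_vector \<Rightarrow> 'a set \<Rightarrow> ('a \<Rightarrow> real) set"
  where "annihilator u B = {\<phi> \<in> pure_states_closure u. \<forall>b\<in>B. \<phi> b = 0}"

definition zero_set :: "('a \<Rightarrow> real) set \<Rightarrow> 'a set"
  where "zero_set M = {x. \<forall>\<phi>\<in>M. \<phi> x = 0}"

definition bisaturated :: "'v::real_vector topology \<Rightarrow> 'v set \<Rightarrow> 'v set \<Rightarrow> bool"
  where "bisaturated T V M \<longleftrightarrow> M \<subseteq> V \<and>
    M = V \<inter> T closure_of (affine hull (V - V \<inter> T closure_of (affine hull (V - M))))"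

end

theory Submission
  imports Defs
begin

text \<open>
  Write \<open>V\<close> for the closure of the pure states, \<open>N\<close> for the annihilator in \<open>V\<close> and \<open>Z\<close> for the zero
  set. Pure states detect positivity, and the infimum of a pure state over the upper bounds of
  \<open>w\<close> and \<open>- w\<close> is its absolute value at \<open>w\<close>; hence \<open>x\<close> and \<open>y\<close> are disjoint iff every functional
  in \<open>V\<close> vanishes at \<open>x\<close> or at \<open>y\<close>. The disjoint complement of \<open>B\<close> is therefore \<open>Z (V - N B)\<close>.
  Since functionals in \<open>V\<close> take the value 1 at \<open>u\<close>, the trace on \<open>V\<close> of the closed affine hull of
  \<open>M \<subseteq> V\<close> equals that of its closed linear span, which is \<open>N (Z M)\<close>. So bisaturation of \<open>N B\<close>
  says that \<open>B\<close> and its double disjoint complement, both of the form \<open>Z M\<close>, have the same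
  annihilator, and the Galois connection between \<open>N\<close> and \<open>Z\<close> makes them equal.
\<close>

section \<open>Sublinear functionals and extreme points\<close>

text \<open>Homogeneity is asked only as an inequality, the form that infima inherit directly;
  \<open>sublinear_scale\<close> recovers the equality.\<close>

definition sublinear :: "('v::real_vector \<Rightarrow> real) \<Rightarrow> bool"
  where "sublinear q \<longleftrightarrow>
    (\<forall>x y. q (x + y) \<le> q x + q y) \<and> (\<forall>c x. 0 \<le> c \<longrightarrow> q (c *\<^sub>R x) \<le> c * q x)"

lemma sublinear_add: "sublinear q \<Longrightarrow> q (x + y) \<le> q x + q y"
  and sublinear_scale_le: "sublinear q \<Longrightarrow> 0 \<le> c \<Longrightarrow> q (c *\<^sub>R x) \<le> c * q x"
  by (auto simp: sublinear_def)

lemma sublinear_zero: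
  assumes "sublinear q"
  shows "q 0 = 0"
  using sublinear_add[OF assms, of 0 0] sublinear_scale_le[OF assms, of 0 0] by simp

lemma sublinear_scale:
  assumes "sublinear q" "0 \<le> c"
  shows "q (c *\<^sub>R x) = c * q x"
proof (cases "c = 0")
  case True
  then show ?thesis using sublinear_zero[OF assms(1)] by simp
next
  case False
  with assms have "c > 0" by simp
  have "q x \<le> (1 / c) * q (c *\<^sub>R x)"
    using sublinear_scale_le[OF assms(1), of "1 / c" "c *\<^sub>R x"] \<open>c > 0\<close> by simp
  then have "c * q x \<le> q (c *\<^sub>R x)"
    using \<open>c > 0\<close> by (simp add: field_simps)
  then show ?thesis using sublinear_scale_le[OF assms, of x] by simp
qed

lemma sublinear_minus_le:
  assumes "sublinear q"
  shows "- q (- x) \<le> q x"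
  using sublinear_add[OF assms, of x "- x"] sublinear_zero[OF assms] by simp

text \<open>The common source of sublinearity for everything built as an infimum:
  \<open>tilt\<close>, infima of chains, \<open>upper_gauge\<close>, and the minimization over upper
  bounds in \<open>pure_state_modulus\<close>.\<close>

lemma sublinear_Inf:
  fixes S :: "'v::real_vector \<Rightarrow> real set"
  assumes ne: "\<And>v. S v \<noteq> {}" and bdd: "\<And>v. bdd_below (S v)"
    and add: "\<And>a b r s. r \<in> S a \<Longrightarrow> s \<in> S b \<Longrightarrow> \<exists>t\<in>S (a + b). t \<le> r + s"
    and scale: "\<And>c v r. 0 \<le> c \<Longrightarrow> r \<in> S v \<Longrightarrow> \<exists>t\<in>S (c *\<^sub>R v). t \<le> c * r"
  shows "sublinear (\<lambda>v. Inf (S v))"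
  unfolding sublinear_def
proof (intro conjI allI impI)
  fix a b
  have *: "Inf (S (a + b)) \<le> r + s" if "r \<in> S a" "s \<in> S b" for r s
    using add[OF that] by (meson bdd cInf_lower order_trans)
  have "Inf (S (a + b)) - s \<le> Inf (S a)" if "s \<in> S b" for s
    by (rule cInf_greatest[OF ne]) (use * that in \<open>force simp: algebra_simps\<close>)
  then have "Inf (S (a + b)) - Inf (S a) \<le> Inf (S b)"
    by (intro cInf_greatest[OF ne]) (force simp: algebra_simps)
  then show "Inf (S (a + b)) \<le> Inf (S a) + Inf (S b)" by simp
next
  fix c :: real and v
  assume "0 \<le> c"
  have *: "Inf (S (c *\<^sub>R v)) \<le> c * r" if "r \<in> S v" for r
    using scale[OF \<open>0 \<le> c\<close> that] by (meson bdd cInf_lower order_trans)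
  show "Inf (S (c *\<^sub>R v)) \<le> c * Inf (S v)"
  proof (cases "c = 0")
    case True
    obtain r where "r \<in> S v" using ne by blast
    from *[OF this] True show ?thesis by simp
  next
    case False
    with \<open>0 \<le> c\<close> have "c > 0" by simp
    have "Inf (S (c *\<^sub>R v)) / c \<le> Inf (S v)"
      by (rule cInf_greatest[OF ne]) (use * \<open>c > 0\<close> in \<open>force simp: field_simps\<close>)
    then show ?thesis using \<open>c > 0\<close> by (simp add: field_simps)
  qed
qed

text \<open>The linear functionals below \<open>tilt q w\<close> are exactly those below \<open>q\<close> that attain the value
  \<open>q w\<close> at \<open>w\<close>.\<close>

definition tilt :: "('v::real_vector \<Rightarrow> real) \<Rightarrow> 'v \<Rightarrow> 'v \<Rightarrow> real"
  where "tilt q w v = Inf ((\<lambda>t. q (v + t *\<^sub>R w) - t * q w) ` {0..})"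

lemma tilt_bdd:
  assumes "sublinear q"
  shows "bdd_below ((\<lambda>t. q (v + t *\<^sub>R w) - t * q w) ` {0..})"
proof (rule bdd_belowI2)
  fix t :: real
  assume "t \<in> {0..}"
  then have "t * q w = q (t *\<^sub>R w)" using sublinear_scale[OF assms] by simp
  also have "\<dots> \<le> q (v + t *\<^sub>R w) + q (- v)"
    using sublinear_add[OF assms, of "v + t *\<^sub>R w" "- v"] by (simp add: algebra_simps)
  finally show "- q (- v) \<le> q (v + t *\<^sub>R w) - t * q w" by simp
qed

lemma tilt_le:
  assumes "sublinear q" "0 \<le> t"
  shows "tilt q w v \<le> q (v + t *\<^sub>R w) - t * q w"
  unfolding tilt_def using tilt_bdd[OF assms(1)] assms(2)
  by (intro cInf_lower) auto

lemma tilt_le_self: "sublinear q \<Longrightarrow> tilt q w v \<le> q v"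
  using tilt_le[of q 0 w v] by simp

lemma le_tilt:
  assumes "\<And>t. 0 \<le> t \<Longrightarrow> r \<le> q (v + t *\<^sub>R w) - t * q w"
  shows "r \<le> tilt q w v"
  unfolding tilt_def by (rule cInf_greatest) (use assms in auto)

lemma sublinear_tilt:
  assumes q: "sublinear q"
  shows "sublinear (tilt q w)"
  unfolding tilt_def[abs_def]
proof (rule sublinear_Inf)
  fix v show "bdd_below ((\<lambda>t. q (v + t *\<^sub>R w) - t * q w) ` {0..})"
    by (rule tilt_bdd[OF q])
next
  fix a b r s
  assume "r \<in> (\<lambda>t. q (a + t *\<^sub>R w) - t * q w) ` {0..}"
    and "s \<in> (\<lambda>t. q (b + t *\<^sub>R w) - t * q w) ` {0..}"
  then obtain t t' where t: "0 \<le> t" "r = q (a + t *\<^sub>R w) - t * q w"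
    and t': "0 \<le> t'" "s = q (b + t' *\<^sub>R w) - t' * q w" by auto
  have "a + b + (t + t') *\<^sub>R w = (a + t *\<^sub>R w) + (b + t' *\<^sub>R w)"
    by (simp add: algebra_simps)
  then have "q (a + b + (t + t') *\<^sub>R w) - (t + t') * q w \<le> r + s"
    using sublinear_add[OF q, of "a + t *\<^sub>R w" "b + t' *\<^sub>R w"] t t'
    by (simp add: algebra_simps)
  then show "\<exists>x\<in>(\<lambda>t. q (a + b + t *\<^sub>R w) - t * q w) ` {0..}. x \<le> r + s"
    using t t' by (intro bexI[OF _ imageI[of "t + t'"]]) auto
next
  fix c :: real and v r
  assume c: "0 \<le> c" and "r \<in> (\<lambda>t. q (v + t *\<^sub>R w) - t * q w) ` {0..}"
  then obtain t where t: "0 \<le> t" "r = q (v + t *\<^sub>R w) - t * q w" by auto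
  have "q (c *\<^sub>R v + (c * t) *\<^sub>R w) - (c * t) * q w \<le> c * r"
    unfolding t(2) using sublinear_scale[OF q c, of "v + t *\<^sub>R w"] by (simp add: algebra_simps)
  then show "\<exists>x\<in>(\<lambda>t. q (c *\<^sub>R v + t *\<^sub>R w) - t * q w) ` {0..}. x \<le> c * r"
    using t c by (intro bexI[OF _ imageI[of "c * t"]]) auto
qed auto

definition dominated :: "('v::real_vector \<Rightarrow> real) \<Rightarrow> ('v \<Rightarrow> real) set"
  where "dominated p = {\<phi>. linear \<phi> \<and> \<phi> \<le> p}"

text \<open>The linear functionals below \<open>q\<close> form a face of those below \<open>p\<close>.\<close>

definition facial :: "('v::real_vector \<Rightarrow> real) \<Rightarrow> ('v \<Rightarrow> real) \<Rightarrow> bool"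
  where "facial p q \<longleftrightarrow>
    (\<forall>\<phi>\<in>dominated p. \<forall>\<psi>\<in>dominated p. \<forall>t. 0 < t \<and> t < 1 \<longrightarrow>
      (\<forall>x. (1 - t) * \<phi> x + t * \<psi> x \<le> q x) \<longrightarrow> \<phi> \<le> q \<and> \<psi> \<le> q)"

lemma convex_combination_attains:
  fixes a b m t :: real
  assumes "0 < t" "t < 1" "a \<le> m" "b \<le> m" "m \<le> (1 - t) * a + t * b"
  shows "a = m \<and> b = m"
proof -
  have "(1 - t) * (m - a) + t * (m - b) \<le> 0" using assms(5) by (simp add: algebra_simps)
  moreover have "0 \<le> (1 - t) * (m - a)" "0 \<le> t * (m - b)" using assms by auto
  ultimately have "(1 - t) * (m - a) = 0" "t * (m - b) = 0" by linarith+
  then show ?thesis using assms by auto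
qed

text \<open>A combination below \<open>tilt q w\<close> is at most \<open>- q w\<close> at
  \<open>- w\<close>, so at \<open>w\<close> it reaches the largest possible value
  \<open>q w\<close>. Then both of its terms attain \<open>q w\<close> there, which puts each of
  them below the tilt.\<close>

lemma facial_tilt:
  assumes q: "sublinear q" and face: "facial p q"
  shows "facial p (tilt q w)"
  unfolding facial_def
proof (intro ballI allI impI)
  fix \<phi> \<psi> and t :: real
  assume \<phi>: "\<phi> \<in> dominated p" and \<psi>: "\<psi> \<in> dominated p" and t: "0 < t \<and> t < 1"
    and le: "\<forall>x. (1 - t) * \<phi> x + t * \<psi> x \<le> tilt q w x"
  have "\<forall>x. (1 - t) * \<phi> x + t * \<psi> x \<le> q x"
    using le tilt_le_self[OF q] order_trans by blast
  with face \<phi> \<psi> t have leq: "\<phi> \<le> q" "\<psi> \<le> q" unfolding facial_def by blast+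
  have lin: "linear \<phi>" "linear \<psi>" using \<phi> \<psi> by (auto simp: dominated_def)
  have "(1 - t) * \<phi> (- w) + t * \<psi> (- w) \<le> - q w"
    using le[rule_format, of "- w"] tilt_le[OF q, of 1 w "- w"] sublinear_zero[OF q] by simp
  then have "q w \<le> (1 - t) * \<phi> w + t * \<psi> w"
    by (simp add: linear_neg[OF lin(1)] linear_neg[OF lin(2)])
  with t leq have eq: "\<phi> w = q w \<and> \<psi> w = q w"
    by (intro convex_combination_attains) (auto simp: le_fun_def)
  have "\<theta> v \<le> tilt q w v" if "linear \<theta>" "\<theta> \<le> q" "\<theta> w = q w" for \<theta> v
  proof (rule le_tilt)
    fix s :: real
    have "\<theta> v = \<theta> (v + s *\<^sub>R w) - s * q w"
      using that by (simp add: linear_add linear_scale)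
    then show "\<theta> v \<le> q (v + s *\<^sub>R w) - s * q w"
      using that(2) by (simp add: le_fun_def)
  qed
  with lin leq eq show "\<phi> \<le> tilt q w \<and> \<psi> \<le> tilt q w"
    by (auto simp: le_fun_def)
qed

lemma linear_le_imp_eq:
  fixes f g :: "'v::real_vector \<Rightarrow> real"
  assumes "linear f" "linear g" "f \<le> g"
  shows "f = g"
proof
  fix x
  show "f x = g x"
    using le_funD[OF assms(3), of x] le_funD[OF assms(3), of "- x"]
    by (simp add: linear_neg[OF assms(1)] linear_neg[OF assms(2)])
qed

text \<open>Hahn--Banach and Krein--Milman in one application of Zorn's lemma: a minimal sublinear
  functional among those with the face property equals all its tilts, which forces it to be linear,
  and a linear functional with the face property is an extreme point.\<close>

lemma extreme_dominated_attains:
  fixes p :: "'v::real_vector \<Rightarrow> real"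
  assumes p: "sublinear p"
  obtains L where "L extreme_point_of dominated p" "L w = p w"
proof -
  \<comment> \<open>Staying below \<open>tilt p w\<close>, and not merely below \<open>p\<close>, is
    what later yields \<open>L w = p w\<close>.\<close>
  define A where "A = {q. sublinear q \<and> q \<le> tilt p w \<and> facial p q}"
  have tiltp: "sublinear (tilt p w)" by (rule sublinear_tilt[OF p])
  have "facial p p" by (auto simp: facial_def dominated_def)
  then have inA: "tilt p w \<in> A"
    using tiltp facial_tilt[OF p] by (auto simp: A_def)
  have "\<exists>m\<in>A. \<forall>a\<in>A. a \<le> m \<longrightarrow> a = m"
  proof (rule predicate_Zorn)
    \<comment> \<open>The order is reversed, since a minimal element is sought.\<close>
    show "partial_order_on A (relation_of (\<lambda>a b. b \<le> a) A)"
      by (auto simp: partial_order_on_def preorder_on_def relation_of_def refl_on_def trans_def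
          antisym_def)
  next
    fix C
    assume "C \<in> Chains (relation_of (\<lambda>a b. b \<le> a) A)"
    then have C: "C \<subseteq> A" and chain: "\<And>a b. a \<in> C \<Longrightarrow> b \<in> C \<Longrightarrow> a \<le> b \<or> b \<le> a"
      by (auto simp: Chains_def relation_of_def)
    show "\<exists>m\<in>A. \<forall>a\<in>C. m \<le> a"
    proof (cases "C = {}")
      case True
      then show ?thesis using inA by blast
    next
      case False
      define g where "g v = Inf ((\<lambda>q. q v) ` C)" for v
      \<comment> \<open>The bound is uniform in \<open>q\<close>: combine
        \<open>- q (- v) \<le> q v\<close> with \<open>q \<le> tilt p w\<close>.\<close>
      have bdd: "bdd_below ((\<lambda>q. q v) ` C)" for v
      proof (rule bdd_belowI2)
        fix q
        assume "q \<in> C"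
        then have q: "sublinear q" "q \<le> tilt p w" using C by (auto simp: A_def)
        then show "- tilt p w (- v) \<le> q v"
          using sublinear_minus_le[OF q(1), of v] le_funD[OF q(2), of "- v"] by linarith
      qed
      have lower: "g \<le> q" if "q \<in> C" for q
        unfolding g_def le_fun_def using that bdd by (auto intro: cInf_lower)
      have greatest: "f \<le> g" if "\<And>q. q \<in> C \<Longrightarrow> f \<le> q" for f
        unfolding g_def le_fun_def using that False by (auto intro!: cInf_greatest simp: le_fun_def)
      have "sublinear g"
        unfolding g_def[abs_def]
      proof (rule sublinear_Inf)
        fix a b r s
        assume "r \<in> (\<lambda>q. q a) ` C" "s \<in> (\<lambda>q. q b) ` C"
        then obtain q q' where q: "q \<in> C" "q' \<in> C" "r = q a" "s = q' b" by auto
        \<comment> \<open>The smaller of two chain members serves for both arguments.\<close>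
        then obtain k where k: "k \<in> C" "k \<le> q" "k \<le> q'" using chain by blast
        then have "sublinear k" using C by (auto simp: A_def)
        then have "k (a + b) \<le> k a + k b" by (rule sublinear_add)
        also have "\<dots> \<le> r + s" using k q by (auto simp: le_fun_def intro: add_mono)
        finally show "\<exists>t\<in>(\<lambda>q. q (a + b)) ` C. t \<le> r + s" using k by auto
      next
        fix c :: real and v r
        assume c: "0 \<le> c" and "r \<in> (\<lambda>q. q v) ` C"
        then obtain q where q: "q \<in> C" "r = q v" by auto
        then have "sublinear q" using C by (auto simp: A_def)
        from sublinear_scale_le[OF this c, of v] q
        show "\<exists>t\<in>(\<lambda>q. q (c *\<^sub>R v)) ` C. t \<le> c * r" by auto
      qed (use False bdd in auto)
      moreover have "g \<le> tilt p w"
      proof -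
        obtain q where "q \<in> C" using False by blast
        with lower[of q] C show ?thesis unfolding A_def by (blast intro: order_trans)
      qed
      moreover have "facial p g"
        unfolding facial_def
      proof (intro ballI allI impI)
        fix \<phi> \<psi> and t :: real
        assume \<phi>: "\<phi> \<in> dominated p" and \<psi>: "\<psi> \<in> dominated p" and t: "0 < t \<and> t < 1"
          and le: "\<forall>x. (1 - t) * \<phi> x + t * \<psi> x \<le> g x"
        have "\<phi> \<le> q \<and> \<psi> \<le> q" if "q \<in> C" for q
        proof -
          have "facial p q" using that C by (auto simp: A_def)
          moreover have "\<forall>x. (1 - t) * \<phi> x + t * \<psi> x \<le> q x"
            using le le_funD[OF lower[OF that]] by (blast intro: order_trans)
          ultimately show ?thesis using \<phi> \<psi> t unfolding facial_def by blast
        qed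
        then show "\<phi> \<le> g \<and> \<psi> \<le> g" using greatest by blast
      qed
      ultimately show ?thesis using lower by (auto simp: A_def)
    qed
  qed
  then obtain L where LA: "L \<in> A" and min: "\<And>a. a \<in> A \<Longrightarrow> a \<le> L \<Longrightarrow> a = L" by blast
  have L: "sublinear L" "L \<le> tilt p w" "facial p L" using LA by (auto simp: A_def)
  have tiltL: "tilt L x = L" for x
  proof (rule min)
    show "tilt L x \<le> L" using tilt_le_self[OF L(1)] by (auto simp: le_fun_def)
    then show "tilt L x \<in> A"
      using L sublinear_tilt facial_tilt by (auto simp: A_def)
  qed
  \<comment> \<open>At parameter 1 the tilt gives \<open>L v \<le> L (v + x) - L x\<close>, the
    superadditivity that sublinearity lacks.\<close>
  have add: "L (v + x) = L v + L x" for v x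
    using tilt_le[OF L(1), of 1 x v] tiltL[of x] sublinear_add[OF L(1), of v x] by simp
  have neg: "L (- x) = - L x" for x
    using add[of x "- x"] sublinear_zero[OF L(1)] by simp
  have lin: "linear L"
  proof (rule linearI)
    fix c :: real and x
    show "L (c *\<^sub>R x) = c *\<^sub>R L x"
    proof (cases "0 \<le> c")
      case True
      then show ?thesis using sublinear_scale[OF L(1)] by simp
    next
      case False
      then show ?thesis
        using sublinear_scale[OF L(1), of "- c" x] neg[of "c *\<^sub>R x"] by simp
    qed
  qed (rule add)
  have Lp: "L \<le> p"
    by (rule order_trans[OF L(2)]) (simp add: le_fun_def tilt_le_self[OF p])
  have "L extreme_point_of dominated p"
    unfolding extreme_point_of_def
  proof (intro conjI ballI)
    show "L \<in> dominated p" using lin Lp by (simp add: dominated_def)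
    fix \<phi> \<psi>
    assume \<phi>: "\<phi> \<in> dominated p" and \<psi>: "\<psi> \<in> dominated p"
    show "L \<notin> open_segment \<phi> \<psi>"
    proof
      assume "L \<in> open_segment \<phi> \<psi>"
      then obtain t where ne: "\<phi> \<noteq> \<psi>" and t: "0 < t" "t < 1"
        and eq: "L = (1 - t) *\<^sub>R \<phi> + t *\<^sub>R \<psi>" by (auto simp: in_segment)
      \<comment> \<open>Since \<open>L\<close> is this combination, the face property places both
        endpoints below \<open>L\<close>; being linear, they coincide with it.\<close>
      have "\<forall>x. (1 - t) * \<phi> x + t * \<psi> x \<le> L x" by (simp add: eq scaleR_fun_def)
      with L(3) \<phi> \<psi> t have "\<phi> \<le> L" "\<psi> \<le> L" unfolding facial_def by blast+
      with lin \<phi> \<psi> have "\<phi> = L" "\<psi> = L"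
        by (auto simp: dominated_def intro: linear_le_imp_eq)
      with ne show False by simp
    qed
  qed
  moreover have "L w = p w"
  proof (rule antisym)
    show "L w \<le> p w" using Lp by (simp add: le_fun_def)
    have "L (- w) \<le> p 0 - p w"
      using le_funD[OF L(2), of "- w"] tilt_le[OF p, of 1 w "- w"] by simp
    then show "p w \<le> L w" using neg sublinear_zero[OF p] by simp
  qed
  ultimately show thesis by (rule that)
qed

section \<open>States of an order unit space\<close>

text \<open>Raising the coefficient by 1 makes it strictly positive, as the set defining
  \<open>unit_norm\<close> demands.\<close>

lemma order_unit_upper:
  assumes "order_unit u"
  obtains \<alpha> where "0 < \<alpha>" "- (\<alpha> *\<^sub>R u) \<le> x" "x \<le> \<alpha> *\<^sub>R u"
proof -
  from assms obtain \<alpha> where \<alpha>: "0 \<le> \<alpha>" "- (\<alpha> *\<^sub>R u) \<le> x" "x \<le> \<alpha> *\<^sub>R u" and u: "0 \<le> u"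
    unfolding order_unit_def by blast
  have "\<alpha> *\<^sub>R u \<le> (\<alpha> + 1) *\<^sub>R u" using u by (intro scaleR_right_mono) auto
  then have "- ((\<alpha> + 1) *\<^sub>R u) \<le> x" "x \<le> (\<alpha> + 1) *\<^sub>R u"
    using \<alpha>(2,3) by (blast intro: order_trans le_imp_neg_le)+
  with \<alpha>(1) show thesis by (intro that[of "\<alpha> + 1"]) auto
qed

lemma positive_linear_mono:
  fixes \<phi> :: "'a::ordered_real_vector \<Rightarrow> real"
  assumes "linear \<phi>" "\<And>x. 0 \<le> x \<Longrightarrow> 0 \<le> \<phi> x" "x \<le> y"
  shows "\<phi> x \<le> \<phi> y"
  using assms(2)[of "y - x"] assms(3) by (simp add: linear_diff[OF assms(1)])

lemma positive_linear_abs_le: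
  fixes \<phi> :: "'a::ordered_real_vector \<Rightarrow> real"
  assumes "linear \<phi>" "\<And>x. 0 \<le> x \<Longrightarrow> 0 \<le> \<phi> x" "- (\<alpha> *\<^sub>R u) \<le> x" "x \<le> \<alpha> *\<^sub>R u"
  shows "\<bar>\<phi> x\<bar> \<le> \<alpha> * \<phi> u"
  using positive_linear_mono[OF assms(1,2,3)] positive_linear_mono[OF assms(1,2,4)]
  by (simp add: linear_neg[OF assms(1)] linear_scale[OF assms(1)])

text \<open>The norm bound is automatic: positivity and \<open>\<phi> u = 1\<close> give
  \<open>\<bar>\<phi> x\<bar> \<le> \<alpha>\<close> for every admissible \<open>\<alpha>\<close>,
  hence also for their infimum.\<close>

lemma state_space_iff:
  assumes "order_unit u"
  shows "\<phi> \<in> state_space u \<longleftrightarrow> linear \<phi> \<and> (\<forall>x\<ge>0. 0 \<le> \<phi> x) \<and> \<phi> u = 1"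
proof -
  have "\<exists>C. \<forall>x. \<bar>\<phi> x\<bar> \<le> C * unit_norm u x"
    if \<phi>: "linear \<phi>" "\<And>x. 0 \<le> x \<Longrightarrow> 0 \<le> \<phi> x" "\<phi> u = 1"
  proof (intro exI[of _ 1] allI)
    fix x
    have "\<bar>\<phi> x\<bar> \<le> unit_norm u x"
      unfolding unit_norm_def
    proof (rule cInf_greatest)
      show "{\<alpha>. 0 < \<alpha> \<and> - (\<alpha> *\<^sub>R u) \<le> x \<and> x \<le> \<alpha> *\<^sub>R u} \<noteq> {}"
        using order_unit_upper[OF assms, of x] by blast
    qed (use positive_linear_abs_le[OF \<phi>(1,2)] \<phi>(3) in force)
    then show "\<bar>\<phi> x\<bar> \<le> 1 * unit_norm u x" by simp
  qed
  then show ?thesis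
    by (auto simp: state_space_def dual_cone_def norm_dual_def)
qed

section \<open>The gauge of the order unit and the positivity test by pure states\<close>

definition upper_gauge :: "'a::ordered_real_vector \<Rightarrow> 'a \<Rightarrow> real"
  where "upper_gauge u v = Inf {\<alpha>. v \<le> \<alpha> *\<^sub>R u}"

lemma scaleR_le_imp_le:
  fixes u :: "'a::ordered_real_vector"
  assumes "0 \<le> u" "u \<noteq> 0" "\<alpha> *\<^sub>R u \<le> \<beta> *\<^sub>R u"
  shows "\<alpha> \<le> \<beta>"
proof (rule ccontr)
  assume "\<not> \<alpha> \<le> \<beta>"
  then have "\<beta> < \<alpha>" by simp
  have "(\<alpha> - \<beta>) *\<^sub>R u \<le> 0" using assms(3) by (simp add: algebra_simps)
  then have "inverse (\<alpha> - \<beta>) *\<^sub>R (\<alpha> - \<beta>) *\<^sub>R u \<le> inverse (\<alpha> - \<beta>) *\<^sub>R 0"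
    using \<open>\<beta> < \<alpha>\<close> by (intro scaleR_left_mono) auto
  then have "u \<le> 0" using \<open>\<beta> < \<alpha>\<close> by simp
  with assms show False by simp
qed

text \<open>A lower bound of \<open>v\<close> by a multiple of \<open>u\<close> becomes a bound on
  \<open>\<alpha>\<close> by cancelling \<open>u\<close>, which needs \<open>u\<close> to be
  nonzero.\<close>

lemma upper_gauge_bdd:
  assumes u: "order_unit u" "u \<noteq> 0"
  shows "bdd_below {\<alpha>. v \<le> \<alpha> *\<^sub>R u}"
proof -
  have "0 \<le> u" using u by (simp add: order_unit_def)
  obtain \<beta> where "- (\<beta> *\<^sub>R u) \<le> v" using order_unit_upper[OF u(1)] by blast
  then have "(- \<beta>) *\<^sub>R u \<le> \<alpha> *\<^sub>R u" if "v \<le> \<alpha> *\<^sub>R u" for \<alpha>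
    using that by simp
  then have "- \<beta> \<le> \<alpha>" if "v \<le> \<alpha> *\<^sub>R u" for \<alpha>
    using that scaleR_le_imp_le[OF \<open>0 \<le> u\<close> u(2)] by blast
  then show ?thesis by (intro bdd_belowI[of _ "- \<beta>"]) auto
qed

lemma upper_gauge_le:
  assumes "order_unit u" "u \<noteq> 0" "v \<le> \<alpha> *\<^sub>R u"
  shows "upper_gauge u v \<le> \<alpha>"
  unfolding upper_gauge_def using upper_gauge_bdd[OF assms(1,2)] assms(3)
  by (intro cInf_lower) auto

lemma sublinear_upper_gauge:
  assumes u: "order_unit u" "u \<noteq> 0"
  shows "sublinear (upper_gauge u)"
  unfolding upper_gauge_def[abs_def]
proof (rule sublinear_Inf)
  fix v
  show "{\<alpha>. v \<le> \<alpha> *\<^sub>R u} \<noteq> {}" using order_unit_upper[OF u(1), of v] by blast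
  show "bdd_below {\<alpha>. v \<le> \<alpha> *\<^sub>R u}" by (rule upper_gauge_bdd[OF u])
next
  fix a b r s
  assume "r \<in> {\<alpha>. a \<le> \<alpha> *\<^sub>R u}" "s \<in> {\<alpha>. b \<le> \<alpha> *\<^sub>R u}"
  then have "a + b \<le> (r + s) *\<^sub>R u" by (simp add: scaleR_add_left add_mono)
  then show "\<exists>t\<in>{\<alpha>. a + b \<le> \<alpha> *\<^sub>R u}. t \<le> r + s" by blast
next
  fix c :: real and v r
  assume "0 \<le> c" "r \<in> {\<alpha>. v \<le> \<alpha> *\<^sub>R u}"
  then have "c *\<^sub>R v \<le> (c * r) *\<^sub>R u" using scaleR_left_mono[of v "r *\<^sub>R u" c] by simp
  then show "\<exists>t\<in>{\<alpha>. c *\<^sub>R v \<le> \<alpha> *\<^sub>R u}. t \<le> c * r" by blast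
qed

text \<open>This turns the extreme points found by \<open>extreme_dominated_attains\<close> into
  pure states. Negative \<open>\<alpha>\<close> are allowed in the gauge, so testing at both
  \<open>u\<close> and \<open>- u\<close> forces the value 1 at \<open>u\<close>.\<close>

lemma dominated_upper_gauge:
  assumes u: "order_unit u" "u \<noteq> 0"
  shows "dominated (upper_gauge u) = state_space u"
proof (intro set_eqI iffI)
  fix \<phi>
  assume "\<phi> \<in> dominated (upper_gauge u)"
  then have lin: "linear \<phi>" and le: "\<And>x. \<phi> x \<le> upper_gauge u x"
    by (auto simp: dominated_def le_fun_def)
  have bound: "\<phi> x \<le> \<alpha>" if "x \<le> \<alpha> *\<^sub>R u" for x \<alpha>
    using le[of x] upper_gauge_le[OF u that] by simp
  have "0 \<le> \<phi> x" if "0 \<le> x" for x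
    using bound[of "- x" 0] that by (simp add: linear_neg[OF lin])
  moreover have "\<phi> u = 1"
    using bound[of u 1] bound[of "- u" "-1"] by (simp add: linear_neg[OF lin])
  ultimately show "\<phi> \<in> state_space u" using lin by (simp add: state_space_iff[OF u(1)])
next
  fix \<phi>
  assume "\<phi> \<in> state_space u"
  then have \<phi>: "linear \<phi>" "\<And>x. 0 \<le> x \<Longrightarrow> 0 \<le> \<phi> x" "\<phi> u = 1"
    by (auto simp: state_space_iff[OF u(1)])
  have "\<phi> x \<le> upper_gauge u x" for x
    unfolding upper_gauge_def
  proof (rule cInf_greatest)
    show "{\<alpha>. x \<le> \<alpha> *\<^sub>R u} \<noteq> {}" using order_unit_upper[OF u(1), of x] by blast
    fix \<alpha>
    assume "\<alpha> \<in> {\<alpha>. x \<le> \<alpha> *\<^sub>R u}"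
    then have "\<phi> x \<le> \<phi> (\<alpha> *\<^sub>R u)" by (intro positive_linear_mono[OF \<phi>(1,2)]) auto
    then show "\<phi> x \<le> \<alpha>" using \<phi> by (simp add: linear_scale)
  qed
  with \<phi>(1) show "\<phi> \<in> dominated (upper_gauge u)" by (auto simp: dominated_def le_fun_def)
qed

text \<open>Some pure state attains the gauge at \<open>- x\<close>, so the gauge is at most 0
  there. Hence \<open>- x\<close> lies below \<open>u\<close> scaled by \<open>1 / n\<close> for
  each positive \<open>n\<close>, and the Archimedean property applies.\<close>

lemma pure_states_nonneg_imp_nonneg:
  fixes u x :: "'a::ordered_real_vector"
  assumes arch: "\<forall>x y :: 'a. (\<forall>n::nat. real n *\<^sub>R x \<le> y) \<longrightarrow> x \<le> 0"
    and unit: "order_unit u" and pos: "\<And>\<phi>. \<phi> \<in> pure_states u \<Longrightarrow> 0 \<le> \<phi> x"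
  shows "0 \<le> x"
proof (cases "u = 0")
  case True
  obtain \<alpha> where "- (\<alpha> *\<^sub>R u) \<le> x" using order_unit_upper[OF unit] .
  with True show ?thesis by simp
next
  case False
  have u: "0 \<le> u" using unit by (simp add: order_unit_def)
  obtain \<phi> where ext: "\<phi> extreme_point_of dominated (upper_gauge u)"
    and \<phi>: "\<phi> (- x) = upper_gauge u (- x)"
    using extreme_dominated_attains[OF sublinear_upper_gauge[OF unit False]] .
  have pure: "\<phi> \<in> pure_states u"
    using ext by (simp add: pure_states_def dominated_upper_gauge[OF unit False])
  then have "\<phi> \<in> state_space u" by (simp add: pure_states_def extreme_point_of_def)
  then have "linear \<phi>" by (simp add: state_space_iff[OF unit])
  then have gauge: "upper_gauge u (- x) \<le> 0" using pos[OF pure] \<phi> by (simp add: linear_neg)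
  have "real n *\<^sub>R (- x) \<le> u" for n
  proof (cases "n = 0")
    case False
    have less: "Inf {\<alpha>. - x \<le> \<alpha> *\<^sub>R u} < 1 / real n"
      unfolding upper_gauge_def[symmetric] using False
      by (intro order_le_less_trans[OF gauge]) simp
    obtain \<beta> where "- x \<le> \<beta> *\<^sub>R u" using order_unit_upper[OF unit] .
    then have "{\<alpha>. - x \<le> \<alpha> *\<^sub>R u} \<noteq> {}" by blast
    from cInf_lessD[OF this less] obtain \<alpha> where \<alpha>: "- x \<le> \<alpha> *\<^sub>R u" "\<alpha> < 1 / real n"
      by auto
    note \<alpha>(1)
    also have "\<alpha> *\<^sub>R u \<le> (1 / real n) *\<^sub>R u" using \<alpha> u by (intro scaleR_right_mono) auto
    finally have "real n *\<^sub>R (- x) \<le> real n *\<^sub>R ((1 / real n) *\<^sub>R u)"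
      by (rule scaleR_left_mono) simp
    then show ?thesis using False by simp
  qed (use u in simp)
  then have "- x \<le> 0" using arch by blast
  then show ?thesis by simp
qed

text \<open>Normalized at \<open>u\<close>, the two summands are states with \<open>\<phi>\<close>
  as a convex combination, so extremality makes them equal. If one has value 0 at \<open>u\<close>,
  it vanishes everywhere by positivity.\<close>

lemma pure_state_summand:
  fixes u :: "'a::ordered_real_vector"
  assumes unit: "order_unit u" and pure: "\<phi> \<in> pure_states u"
    and \<psi>: "linear \<psi>" "\<And>x. 0 \<le> x \<Longrightarrow> 0 \<le> \<psi> x"
    and \<theta>: "linear \<theta>" "\<And>x. 0 \<le> x \<Longrightarrow> 0 \<le> \<theta> x"
    and sum: "\<And>x. \<psi> x + \<theta> x = \<phi> x"
  shows "\<psi> x = \<psi> u * \<phi> x"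
proof -
  have vanish: "\<eta> y = 0" if "linear \<eta>" "\<And>x. 0 \<le> x \<Longrightarrow> 0 \<le> \<eta> x" "\<eta> u = 0" for \<eta> :: "'a \<Rightarrow> real" and y
  proof -
    obtain \<alpha> where "- (\<alpha> *\<^sub>R u) \<le> y" "y \<le> \<alpha> *\<^sub>R u" using order_unit_upper[OF unit] by blast
    from positive_linear_abs_le[OF that(1,2) this] that(3) show ?thesis by simp
  qed
  have ext: "\<phi> extreme_point_of state_space u" using pure by (simp add: pure_states_def)
  then have "\<phi> \<in> state_space u" by (simp add: extreme_point_of_def)
  then have \<phi>u: "\<phi> u = 1" by (simp add: state_space_iff[OF unit])
  have u: "0 \<le> u" using unit by (simp add: order_unit_def)
  have s: "0 \<le> \<psi> u" "0 \<le> \<theta> u" "\<theta> u = 1 - \<psi> u" using \<psi> \<theta> u sum[of u] \<phi>u by auto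
  consider "\<psi> u = 0" | "\<theta> u = 0" | "0 < \<psi> u" "0 < \<theta> u" using s by linarith
  then show ?thesis
  proof cases
    case 1
    then show ?thesis using vanish[OF \<psi>] by simp
  next
    case 2
    then have "\<theta> x = 0" using vanish[OF \<theta>] by simp
    then show ?thesis using sum[of x] s 2 by simp
  next
    case 3
    define \<psi>' where "\<psi>' = (1 / \<psi> u) *\<^sub>R \<psi>"
    define \<theta>' where "\<theta>' = (1 / \<theta> u) *\<^sub>R \<theta>"
    have states: "\<psi>' \<in> state_space u" "\<theta>' \<in> state_space u"
      using 3 \<psi> \<theta> linear_compose_scale_right[of \<psi> "1 / \<psi> u"]
        linear_compose_scale_right[of \<theta> "1 / \<theta> u"]
      unfolding state_space_iff[OF unit] \<psi>'_def \<theta>'_def scaleR_fun_def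
      by auto
    have comb: "\<phi> = (1 - \<theta> u) *\<^sub>R \<psi>' + \<theta> u *\<^sub>R \<theta>'"
      using 3 s by (auto simp: fun_eq_iff \<psi>'_def \<theta>'_def scaleR_fun_def sum)
    have "\<psi>' = \<theta>'"
    proof (rule ccontr)
      assume "\<psi>' \<noteq> \<theta>'"
      then have "\<phi> \<in> open_segment \<psi>' \<theta>'"
        unfolding in_segment using comb 3 s by (intro conjI exI[of _ "\<theta> u"]) auto
      with ext states show False by (auto simp: extreme_point_of_def)
    qed
    with comb have "\<phi> = \<psi>'" by (simp add: fun_eq_iff scaleR_fun_def algebra_simps)
    with 3 show ?thesis by (simp add: \<psi>'_def scaleR_fun_def)
  qed
qed

text \<open>The infimum of \<open>\<phi>\<close> over the upper bounds of \<open>w\<close> and \<open>- w\<close> is, by linear programming duality,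
  the supremum of \<open>\<psi> w - \<theta> w\<close> over all decompositions of \<open>\<phi>\<close> into positive functionals
  \<open>\<psi> + \<theta>\<close>, and for a pure state these are all trivial.\<close>

lemma pure_state_modulus:
  fixes u w :: "'a::ordered_real_vector"
  assumes unit: "order_unit u" and pure: "\<phi> \<in> pure_states u" and less: "\<bar>\<phi> w\<bar> < r"
  obtains z where "w \<le> z" "- w \<le> z" "\<phi> z < r"
proof -
  have "\<phi> \<in> state_space u" using pure by (simp add: pure_states_def extreme_point_of_def)
  then have lin: "linear \<phi>" and pos: "\<And>x. 0 \<le> x \<Longrightarrow> 0 \<le> \<phi> x" and \<phi>u: "\<phi> u = 1"
    by (auto simp: state_space_iff[OF unit])
  \<comment> \<open>The constraints \<open>w \<le> z\<close> and \<open>- w \<le> z\<close> become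
    one parameter in the product space, so that the optimal value \<open>p\<close> is sublinear in
    it.\<close>
  define S where "S v = \<phi> ` {z. fst v \<le> z \<and> snd v \<le> z}" for v :: "'a \<times> 'a"
  define p where "p v = Inf (S v)" for v
  have bdd: "bdd_below (S v)" for v
    unfolding S_def by (rule bdd_belowI2[of _ "\<phi> (fst v)"]) (auto intro: positive_linear_mono[OF lin pos])
  have ne: "S v \<noteq> {}" for v
  proof -
    obtain \<alpha> \<beta> where \<alpha>: "0 < \<alpha>" "fst v \<le> \<alpha> *\<^sub>R u" and \<beta>: "0 < \<beta>" "snd v \<le> \<beta> *\<^sub>R u"
      using order_unit_upper[OF unit] by metis
    have "0 \<le> u" using unit by (simp add: order_unit_def)
    then have "0 \<le> \<alpha> *\<^sub>R u" "0 \<le> \<beta> *\<^sub>R u" using \<alpha> \<beta>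
      by (simp_all add: scaleR_nonneg_nonneg)
    with \<alpha> \<beta> have "fst v \<le> \<alpha> *\<^sub>R u + \<beta> *\<^sub>R u" "snd v \<le> \<alpha> *\<^sub>R u + \<beta> *\<^sub>R u"
      by (auto intro: add_increasing add_increasing2)
    then show ?thesis by (auto simp: S_def)
  qed
  have p: "sublinear p"
    unfolding p_def[abs_def]
  proof (rule sublinear_Inf[OF ne bdd])
    fix a b r s
    assume "r \<in> S a" "s \<in> S b"
    then obtain y z where "fst a \<le> y" "snd a \<le> y" "r = \<phi> y" "fst b \<le> z" "snd b \<le> z" "s = \<phi> z"
      by (auto simp: S_def)
    then show "\<exists>t\<in>S (a + b). t \<le> r + s"
      by (intro bexI[of _ "\<phi> (y + z)"])
        (auto simp: S_def linear_add[OF lin] intro!: image_eqI[of _ _ "y + z"] add_mono)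
  next
    fix c :: real and v r
    assume "0 \<le> c" "r \<in> S v"
    moreover from this obtain z where "fst v \<le> z" "snd v \<le> z" "r = \<phi> z" by (auto simp: S_def)
    ultimately show "\<exists>t\<in>S (c *\<^sub>R v). t \<le> c * r"
      by (intro bexI[of _ "\<phi> (c *\<^sub>R z)"])
        (auto simp: S_def linear_scale[OF lin]
          intro!: image_eqI[of _ _ "c *\<^sub>R z"] scaleR_left_mono)
  qed
  have p_le: "p (a, b) \<le> \<phi> z" if "a \<le> z" "b \<le> z" for a b z
    unfolding p_def using bdd that by (intro cInf_lower) (auto simp: S_def)
  obtain L where "L extreme_point_of dominated p" and attain: "L (w, - w) = p (w, - w)"
    using extreme_dominated_attains[OF p] .
  then have L: "linear L" and Lp: "\<And>v. L v \<le> p v"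
    by (auto simp: extreme_point_of_def dominated_def le_fun_def)
  \<comment> \<open>The two components of \<open>L\<close> form the decomposition of
    \<open>\<phi>\<close>: positivity comes from the feasible point \<open>z = 0\<close> for
    \<open>(- x, 0)\<close> and \<open>(0, - x)\<close>, the sum from \<open>z = x\<close> for
    \<open>(x, x)\<close>.\<close>
  define \<psi> where "\<psi> x = L (x, 0)" for x
  define \<theta> where "\<theta> x = L (0, x)" for x
  have split: "L (a, b) = \<psi> a + \<theta> b" for a b
    using linear_add[OF L, of "(a, 0)" "(0, b)"] by (simp add: \<psi>_def \<theta>_def)
  have \<psi>: "linear \<psi>" and \<theta>: "linear \<theta>"
    using linear_add[OF L, of "(_, 0)" "(_, 0)"] linear_add[OF L, of "(0, _)" "(0, _)"]
      linear_scale[OF L, of _ "(_, 0)"] linear_scale[OF L, of _ "(0, _)"]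
    by (auto intro!: linearI simp: \<psi>_def \<theta>_def)
  have \<psi>_pos: "0 \<le> \<psi> x" and \<theta>_pos: "0 \<le> \<theta> x" if "0 \<le> x" for x
    using Lp[of "(- x, 0)"] p_le[of "- x" 0 0] Lp[of "(0, - x)"] p_le[of 0 0 "- x"] that
    by (auto simp: split linear_neg[OF \<psi>] linear_neg[OF \<theta>] linear_0[OF \<psi>] linear_0[OF \<theta>]
        linear_0[OF lin])
  have "(\<lambda>x. \<psi> x + \<theta> x) = \<phi>"
  proof (rule linear_le_imp_eq)
    show "linear (\<lambda>x. \<psi> x + \<theta> x)" by (rule linear_compose_add[OF \<psi> \<theta>])
    have "\<psi> x + \<theta> x \<le> \<phi> x" for x
      using Lp[of "(x, x)"] p_le[of x x x] by (simp add: split)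
    then show "(\<lambda>x. \<psi> x + \<theta> x) \<le> \<phi>" by (simp add: le_fun_def)
  qed (rule lin)
  then have sum: "\<psi> x + \<theta> x = \<phi> x" for x by (metis (no_types))
  have u: "0 \<le> u" using unit by (simp add: order_unit_def)
  have s: "0 \<le> \<psi> u" "\<psi> u \<le> 1" using \<psi>_pos[OF u] \<theta>_pos[OF u] sum[of u] \<phi>u by auto
  have "\<psi> w = \<psi> u * \<phi> w"
    by (rule pure_state_summand[OF unit pure \<psi> \<psi>_pos \<theta> \<theta>_pos sum])
  \<comment> \<open>The optimal value is
    \<open>\<psi> w - \<theta> w = 2 * \<psi> w - \<phi> w\<close>.\<close>
  then have "p (w, - w) = (2 * \<psi> u - 1) * \<phi> w"
    using attain sum[of w] by (simp add: split linear_neg[OF \<theta>] algebra_simps)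
  also have "\<dots> \<le> \<bar>2 * \<psi> u - 1\<bar> * \<bar>\<phi> w\<bar>" by (metis abs_ge_self abs_mult)
  also have "\<dots> \<le> 1 * \<bar>\<phi> w\<bar>" using s by (intro mult_right_mono) auto
  finally have "p (w, - w) < r" using less by simp
  then obtain t where "t \<in> S (w, - w)" "t < r"
    unfolding p_def using cInf_lessD[OF ne] by blast
  then show thesis by (auto simp: S_def intro: that)
qed

section \<open>Disjointness and annihilators\<close>

lemma closedin_eval:
  "closedin (powertop_real UNIV) {\<phi>. \<phi> x \<in> C}" if "closed C" for C :: "real set" and x :: 'i
proof -
  have "continuous_map (powertop_real UNIV) euclideanreal (\<lambda>\<phi>::'i \<Rightarrow> real. \<phi> x)"
    by (rule continuous_map_product_projection) simp
  from closedin_continuous_map_preimage[OF this, of C] that show ?thesis by simp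
qed

lemma pure_states_subset_state_space: "pure_states u \<subseteq> state_space u"
  by (auto simp: pure_states_def extreme_point_of_def)

lemma state_space_subset_norm_dual: "state_space u \<subseteq> norm_dual u"
  by (auto simp: state_space_def dual_cone_def)

text \<open>Closing inside the norm dual adds no point beyond the closure in the full product, so
  pointwise closed conditions pass from pure states to their closure.\<close>

lemma pure_states_closure_minimal:
  assumes "closedin (powertop_real UNIV) C" "pure_states u \<subseteq> C"
  shows "pure_states_closure u \<subseteq> C"
proof -
  have "pure_states_closure u \<subseteq> powertop_real UNIV closure_of pure_states u"
    by (auto simp: pure_states_closure_def weak_star_def closure_of_subtopology
        intro: closure_of_mono[THEN subsetD, rotated])
  also have "\<dots> \<subseteq> C" using assms by (rule closure_of_minimal[rotated])
  finally show ?thesis .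
qed

lemma pure_states_subset_closure: "pure_states u \<subseteq> pure_states_closure u"
proof -
  have "pure_states u \<subseteq> topspace (weak_star u)"
    using pure_states_subset_state_space[of u] state_space_subset_norm_dual[of u]
    by (auto simp: weak_star_def)
  then show ?thesis unfolding pure_states_closure_def by (rule closure_of_subset)
qed

lemma pure_states_closure_subset_norm_dual: "pure_states_closure u \<subseteq> norm_dual u"
  using closure_of_subset_topspace[of "weak_star u"]
  by (auto simp: pure_states_closure_def weak_star_def)

text \<open>Linearity is built into the norm dual, where the closure is taken; positivity and
  normalization are closed conditions on single values.\<close>

lemma pure_states_closure_state:
  assumes unit: "order_unit u" and \<phi>: "\<phi> \<in> pure_states_closure u"
  shows "linear \<phi>" "0 \<le> x \<Longrightarrow> 0 \<le> \<phi> x" "\<phi> u = 1"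
proof -
  show "linear \<phi>"
    using \<phi> pure_states_closure_subset_norm_dual by (auto simp: norm_dual_def)
  have sub: "pure_states u \<subseteq> {\<phi>. linear \<phi> \<and> (\<forall>x\<ge>0. 0 \<le> \<phi> x) \<and> \<phi> u = 1}"
    using pure_states_subset_state_space[of u] state_space_iff[OF unit] by auto
  show "0 \<le> \<phi> x" if "0 \<le> x"
    using pure_states_closure_minimal[OF closedin_eval[of "{0..}" x], of u] sub \<phi> that by auto
  show "\<phi> u = 1"
    using pure_states_closure_minimal[OF closedin_eval[of "{1}" u], of u] sub \<phi> by auto
qed

text \<open>Upper bounds of \<open>w\<close> and \<open>- w\<close> determine, and are determined
  by, the absolute values of the functionals at \<open>w\<close>. For reals,
  \<open>\<bar>a + b\<bar> = \<bar>a - b\<bar>\<close> holds exactly when \<open>a\<close> or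
  \<open>b\<close> is 0.\<close>

lemma order_disjoint_iff:
  fixes u x y :: "'a::ordered_real_vector"
  assumes arch: "\<forall>x y :: 'a. (\<forall>n::nat. real n *\<^sub>R x \<le> y) \<longrightarrow> x \<le> 0"
    and unit: "order_unit u"
  shows "order_disjoint x y \<longleftrightarrow> (\<forall>\<phi>\<in>pure_states_closure u. \<phi> x = 0 \<or> \<phi> y = 0)"
proof -
  have ub: "upper_bounds {a, b} = {z. a \<le> z \<and> b \<le> z}" for a b :: 'a
    by (auto simp: upper_bounds_def)
  have lin: "linear \<phi>" if "\<phi> \<in> pure_states_closure u" for \<phi>
    by (rule pure_states_closure_state(1)[OF unit that])
  have mono: "\<phi> a \<le> \<phi> b" if "\<phi> \<in> pure_states_closure u" "a \<le> b" for \<phi> a b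
    using pure_states_closure_state[OF unit that(1)] that(2) positive_linear_mono by blast
  have ubm: "upper_bounds {w, - w} = {z. \<forall>\<phi>\<in>pure_states_closure u. \<bar>\<phi> w\<bar> \<le> \<phi> z}" for w
  proof (intro set_eqI iffI)
    fix z
    assume "z \<in> upper_bounds {w, - w}"
    then have z: "w \<le> z" "- w \<le> z" by (auto simp: ub)
    have "\<bar>\<phi> w\<bar> \<le> \<phi> z" if "\<phi> \<in> pure_states_closure u" for \<phi>
      using mono[OF that z(1)] mono[OF that z(2)] by (simp add: linear_neg[OF lin[OF that]])
    then show "z \<in> {z. \<forall>\<phi>\<in>pure_states_closure u. \<bar>\<phi> w\<bar> \<le> \<phi> z}" by blast
  next
    fix z
    assume "z \<in> {z. \<forall>\<phi>\<in>pure_states_closure u. \<bar>\<phi> w\<bar> \<le> \<phi> z}"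
    then have le: "\<bar>\<phi> w\<bar> \<le> \<phi> z" "linear \<phi>" if "\<phi> \<in> pure_states u" for \<phi>
      using that pure_states_subset_closure[of u] lin by auto
    have "0 \<le> z - w"
      by (rule pure_states_nonneg_imp_nonneg[OF arch unit]) (use le in \<open>force simp: linear_diff\<close>)+
    moreover have "0 \<le> z + w"
      by (rule pure_states_nonneg_imp_nonneg[OF arch unit]) (use le in \<open>force simp: linear_add\<close>)+
    then have "0 \<le> z - (- w)" by simp
    ultimately show "z \<in> upper_bounds {w, - w}"
      unfolding ub diff_ge_0_iff_ge by blast
  qed
  have rewr: "order_disjoint x y \<longleftrightarrow>
      upper_bounds {x + y, - (x + y)} = upper_bounds {x - y, - (x - y)}"
    unfolding order_disjoint_def by (simp add: algebra_simps)
  have closed: "closedin (powertop_real UNIV) {\<phi>. \<phi> x = 0 \<or> \<phi> y = (0::real)}"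
    using closedin_Un[OF closedin_eval[of "{0}" x] closedin_eval[of "{0}" y]]
    by (simp add: Collect_disj_eq)
  show ?thesis
  proof
    assume "order_disjoint x y"
    then have eq: "upper_bounds {x + y, - (x + y)} = upper_bounds {x - y, - (x - y)}"
      by (simp add: rewr)
    \<comment> \<open>Otherwise \<open>pure_state_modulus\<close> supplies an upper bound of
      \<open>b\<close> and \<open>- b\<close> with value below \<open>\<bar>\<phi> a\<bar>\<close>,
      which cannot bound both \<open>a\<close> and \<open>- a\<close>.\<close>
    have le: "\<bar>\<phi> a\<bar> \<le> \<bar>\<phi> b\<bar>"
      if \<phi>: "\<phi> \<in> pure_states u" and sub: "upper_bounds {b, - b} \<subseteq> upper_bounds {a, - a}" for \<phi> a b
    proof (rule ccontr)
      assume "\<not> \<bar>\<phi> a\<bar> \<le> \<bar>\<phi> b\<bar>"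
      then have "\<bar>\<phi> b\<bar> < \<bar>\<phi> a\<bar>" by simp
      then obtain z where z: "b \<le> z" "- b \<le> z" "\<phi> z < \<bar>\<phi> a\<bar>"
        by (rule pure_state_modulus[OF unit \<phi>])
      then have "z \<in> upper_bounds {b, - b}" by (simp add: ub)
      with sub have "z \<in> upper_bounds {a, - a}" by (rule subsetD)
      then have "\<bar>\<phi> a\<bar> \<le> \<phi> z" using \<phi> pure_states_subset_closure[of u] unfolding ubm by auto
      with z show False by simp
    qed
    have "\<phi> x = 0 \<or> \<phi> y = 0" if \<phi>: "\<phi> \<in> pure_states u" for \<phi>
    proof -
      have "linear \<phi>" using lin \<phi> pure_states_subset_closure[of u] by auto
      moreover have "\<bar>\<phi> (x + y)\<bar> = \<bar>\<phi> (x - y)\<bar>"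
        by (intro antisym le[OF \<phi>]) (simp_all only: eq order_refl)
      ultimately have "\<bar>\<phi> x + \<phi> y\<bar> = \<bar>\<phi> x - \<phi> y\<bar>" by (simp add: linear_add linear_diff)
      then show ?thesis by linarith
    qed
    \<comment> \<open>The alternative is a union of two closed sets, so it survives the passage to
      the closure.\<close>
    then show "\<forall>\<phi>\<in>pure_states_closure u. \<phi> x = 0 \<or> \<phi> y = 0"
      using pure_states_closure_minimal[OF closed, of u] by blast
  next
    assume zero: "\<forall>\<phi>\<in>pure_states_closure u. \<phi> x = 0 \<or> \<phi> y = 0"
    have "\<bar>\<phi> (x + y)\<bar> = \<bar>\<phi> (x - y)\<bar>" if "\<phi> \<in> pure_states_closure u" for \<phi>
      using zero that by (auto simp: linear_add[OF lin] linear_diff[OF lin])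
    then show "order_disjoint x y" unfolding rewr ubm by auto
  qed
qed

lemma disjoint_complement_eq_zero_set:
  fixes u :: "'a::ordered_real_vector"
  assumes "\<forall>x y :: 'a. (\<forall>n::nat. real n *\<^sub>R x \<le> y) \<longrightarrow> x \<le> 0" "order_unit u"
  shows "disjoint_complement M = zero_set (pure_states_closure u - annihilator u M)"
  unfolding disjoint_complement_def order_disjoint_iff[OF assms]
  by (auto simp: zero_set_def annihilator_def)

text \<open>A functional vanishing on the common kernel of a space of functionals need not belong to that
  space, but on each finite set it coincides with one of its members.\<close>

lemma finite_interpolation:
  fixes S :: "('v::real_vector \<Rightarrow> real) set"
  assumes "finite F" "subspace S" "\<And>\<sigma>. \<sigma> \<in> S \<Longrightarrow> linear \<sigma>" "linear \<phi>"
    and "\<And>x. x \<in> zero_set S \<Longrightarrow> \<phi> x = 0"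
  shows "\<exists>\<psi>\<in>S. \<forall>x\<in>F. \<psi> x = \<phi> x"
  using assms
proof (induction F arbitrary: S \<phi> rule: finite_induct)
  case empty
  then show ?case using subspace_0 by blast
next
  case (insert x F)
  note S = insert.prems(1) and lin = insert.prems(2) and \<phi> = insert.prems(3,4)
  show ?case
  proof (cases "x \<in> zero_set S")
    case True
    obtain \<psi> where \<psi>: "\<psi> \<in> S" "\<forall>y\<in>F. \<psi> y = \<phi> y"
      using insert.IH[OF S lin \<phi>] by blast
    moreover have "\<psi> x = \<phi> x" using True \<psi>(1) \<phi>(2)[OF True] by (simp add: zero_set_def)
    ultimately show ?thesis by blast
  next
    case False
    then obtain \<sigma> where \<sigma>: "\<sigma> \<in> S" "\<sigma> x \<noteq> 0" by (auto simp: zero_set_def)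
    \<comment> \<open>Normalized at \<open>x\<close>, \<open>\<tau>\<close> corrects the value
      there: subtracting its multiple makes \<open>\<phi>\<close> vanish at \<open>x\<close>, and
      the induction hypothesis is applied to the members of \<open>S\<close> that vanish at
      \<open>x\<close>.\<close>
    define \<tau> where "\<tau> = (1 / \<sigma> x) *\<^sub>R \<sigma>"
    have \<tau>: "\<tau> \<in> S" unfolding \<tau>_def by (rule subspace_scale[OF S \<sigma>(1)])
    have \<tau>x: "\<tau> x = 1" using \<sigma> by (simp add: \<tau>_def scaleR_fun_def)
    define T where "T = {\<sigma> \<in> S. \<sigma> x = 0}"
    define \<phi>' where "\<phi>' y = \<phi> y - \<phi> x * \<tau> y" for y
    have "subspace T"
      using S by (auto simp: T_def subspace_def scaleR_fun_def)
    moreover have "linear \<phi>'"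
      unfolding \<phi>'_def[abs_def]
      using linear_compose_sub[OF \<phi>(1) linear_compose_scale_right[OF lin[OF \<tau>], of "\<phi> x"]]
      by simp
    moreover have "\<phi>' y = 0" if "y \<in> zero_set T" for y
    proof -
      \<comment> \<open>Moving \<open>y\<close> along \<open>x\<close> into the kernel of
        \<open>\<tau>\<close> lands in the common kernel of \<open>S\<close>, where
        \<open>\<phi>\<close> vanishes.\<close>
      have "\<sigma> (y - \<tau> y *\<^sub>R x) = 0" if "\<sigma> \<in> S" for \<sigma>
      proof -
        have "\<sigma> - \<sigma> x *\<^sub>R \<tau> \<in> T"
          using \<tau>x subspace_diff[OF S that subspace_scale[OF S \<tau>]]
          by (simp add: T_def scaleR_fun_def)
        then have "(\<sigma> - \<sigma> x *\<^sub>R \<tau>) y = 0" using \<open>y \<in> zero_set T\<close> by (auto simp: zero_set_def)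
        then show ?thesis
          by (simp add: linear_diff[OF lin[OF that]] linear_scale[OF lin[OF that]] scaleR_fun_def
              mult.commute)
      qed
      then have "\<phi> (y - \<tau> y *\<^sub>R x) = 0" by (intro \<phi>(2)) (simp add: zero_set_def)
      then show ?thesis
        by (simp add: \<phi>'_def linear_diff[OF \<phi>(1)] linear_scale[OF \<phi>(1)] mult.commute)
    qed
    ultimately obtain \<psi> where \<psi>: "\<psi> \<in> T" "\<forall>y\<in>F. \<psi> y = \<phi>' y"
      using insert.IH[of T \<phi>'] lin by (auto simp: T_def)
    have "\<psi> + \<phi> x *\<^sub>R \<tau> \<in> S"
      using \<psi> \<tau> S by (auto simp: T_def intro: subspace_add subspace_scale)
    moreover have "\<forall>y\<in>insert x F. (\<psi> + \<phi> x *\<^sub>R \<tau>) y = \<phi> y"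
      using \<psi> \<tau>x by (auto simp: T_def \<phi>'_def scaleR_fun_def)
    ultimately show ?thesis by blast
  qed
qed

section \<open>Closed affine hulls as annihilators\<close>

lemma sum_fun_apply: "(\<Sum>i\<in>A. f i) x = (\<Sum>i\<in>A. f i x)" for f :: "'i \<Rightarrow> 'b \<Rightarrow> 'c::comm_monoid_add"
  by (induction A rule: infinite_finite_induct) auto

text \<open>Evaluating a linear combination at \<open>u\<close> returns the sum of its coefficients,
  which must therefore be 1.\<close>

lemma span_normalized_subset_affine_hull:
  assumes "\<psi> \<in> span M" "\<psi> u = (1::real)" "\<And>m. m \<in> M \<Longrightarrow> m u = 1"
  shows "\<psi> \<in> affine hull M"
proof -
  from assms(1) obtain t r where t: "finite t" "t \<subseteq> M" and \<psi>: "\<psi> = (\<Sum>a\<in>t. r a *\<^sub>R a)"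
    unfolding span_explicit by blast
  have "(\<Sum>a\<in>t. r a *\<^sub>R a) u = (\<Sum>a\<in>t. r a)"
    using t assms(3) by (auto simp: sum_fun_apply scaleR_fun_def intro!: sum.cong)
  then have "sum r t = 1" using \<psi> assms(2) by simp
  moreover from this have "t \<noteq> {}" by auto
  ultimately show ?thesis unfolding affine_hull_explicit using t \<psi> by blast
qed

lemma subspace_norm_dual: "subspace (norm_dual u)"
  unfolding subspace_def
proof (intro conjI ballI allI)
  show "0 \<in> norm_dual u"
    by (auto simp: norm_dual_def zero_fun_def intro!: linear_zero exI[of _ 0])
next
  fix \<phi> \<psi>
  assume "\<phi> \<in> norm_dual u" "\<psi> \<in> norm_dual u"
  then obtain C D where lin: "linear \<phi>" "linear \<psi>"
    and "\<And>x. \<bar>\<phi> x\<bar> \<le> C * unit_norm u x" "\<And>x. \<bar>\<psi> x\<bar> \<le> D * unit_norm u x"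
    by (auto simp: norm_dual_def)
  then have "\<bar>\<phi> x + \<psi> x\<bar> \<le> (C + D) * unit_norm u x" for x
    by (smt (verit) distrib_right)
  then show "\<phi> + \<psi> \<in> norm_dual u"
    using linear_compose_add[OF lin] by (auto simp: norm_dual_def plus_fun_def)
next
  fix c :: real and \<phi>
  assume "\<phi> \<in> norm_dual u"
  then obtain C where lin: "linear \<phi>" and C: "\<And>x. \<bar>\<phi> x\<bar> \<le> C * unit_norm u x"
    by (auto simp: norm_dual_def)
  have "\<bar>c * \<phi> x\<bar> \<le> (\<bar>c\<bar> * C) * unit_norm u x" for x
    using mult_left_mono[OF C[of x], of "\<bar>c\<bar>"] by (simp add: abs_mult mult.assoc)
  then show "c *\<^sub>R \<phi> \<in> norm_dual u"
    using linear_compose_scale_right[OF lin, of c] by (auto simp: norm_dual_def scaleR_fun_def)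
qed

text \<open>Forwards, vanishing at a point is a closed affine condition. Backwards, a functional
  vanishing on the common kernel agrees on any finite set with a member of the affine hull, which is
  weak* approximation.\<close>

lemma closure_affine_hull_eq_annihilator:
  fixes u :: "'a::ordered_real_vector"
  assumes unit: "order_unit u" and M: "M \<subseteq> pure_states_closure u"
  shows "pure_states_closure u \<inter> weak_star u closure_of (affine hull M) =
    annihilator u (zero_set M)"
proof (intro set_eqI iffI)
  fix \<phi>
  assume "\<phi> \<in> pure_states_closure u \<inter> weak_star u closure_of (affine hull M)"
  then have \<phi>: "\<phi> \<in> pure_states_closure u" "\<phi> \<in> powertop_real UNIV closure_of (affine hull M)"
    by (auto simp: weak_star_def closure_of_subtopology intro: closure_of_mono[THEN subsetD, rotated])
  have "\<phi> b = 0" if "b \<in> zero_set M" for b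
  proof -
    have "affine {\<phi>::'a \<Rightarrow> real. \<phi> b = 0}"
      by (auto simp: affine_def scaleR_fun_def)
    then have "affine hull M \<subseteq> {\<phi>. \<phi> b = 0}"
      using that by (intro hull_minimal) (auto simp: zero_set_def)
    then have "powertop_real UNIV closure_of (affine hull M) \<subseteq> {\<phi>. \<phi> b \<in> {0}}"
      by (intro closure_of_minimal closedin_eval) auto
    with \<phi> show ?thesis by auto
  qed
  with \<phi> show "\<phi> \<in> annihilator u (zero_set M)" by (simp add: annihilator_def)
next
  fix \<phi>
  assume "\<phi> \<in> annihilator u (zero_set M)"
  then have \<phi>: "\<phi> \<in> pure_states_closure u" and zero: "\<And>b. b \<in> zero_set M \<Longrightarrow> \<phi> b = 0"
    by (auto simp: annihilator_def)
  have span_dual: "span M \<subseteq> norm_dual u"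
    using M pure_states_closure_subset_norm_dual by (intro span_minimal subspace_norm_dual) blast
  have M_u: "\<And>m. m \<in> M \<Longrightarrow> m u = 1"
    using pure_states_closure_state(3)[OF unit] M by blast
  have interp: "\<exists>\<psi>\<in>affine hull M. \<forall>x\<in>F. \<psi> x = \<phi> x" if "finite F" for F
  proof -
    \<comment> \<open>Including \<open>u\<close> among the interpolation points normalizes the
      interpolant, moving it from the span into the affine hull.\<close>
    have "\<exists>\<psi>\<in>span M. \<forall>x\<in>insert u F. \<psi> x = \<phi> x"
    proof (rule finite_interpolation)
      show "\<And>x. x \<in> zero_set (span M) \<Longrightarrow> \<phi> x = 0"
        by (rule zero) (auto simp: zero_set_def span_base)
    qed (use that span_dual pure_states_closure_state(1)[OF unit \<phi>] in
        \<open>auto simp: norm_dual_def\<close>)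
    then obtain \<psi> where \<psi>: "\<psi> \<in> span M" "\<psi> u = \<phi> u" "\<forall>x\<in>F. \<psi> x = \<phi> x" by auto
    then have "\<psi> \<in> affine hull M"
      using M_u pure_states_closure_state(3)[OF unit \<phi>]
      by (intro span_normalized_subset_affine_hull[of _ _ u]) auto
    with \<psi> show ?thesis by blast
  qed
  have dual: "\<phi> \<in> norm_dual u" using \<phi> pure_states_closure_subset_norm_dual by blast
  have "\<phi> \<in> weak_star u closure_of (affine hull M)"
    unfolding in_closure_of
  proof (intro conjI allI impI)
    show "\<phi> \<in> topspace (weak_star u)" using dual by (simp add: weak_star_def)
    fix W
    assume "\<phi> \<in> W \<and> openin (weak_star u) W"
    then obtain W' where W': "openin (powertop_real UNIV) W'" "W = W' \<inter> norm_dual u" "\<phi> \<in> W'"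
      by (auto simp: weak_star_def openin_subtopology)
    \<comment> \<open>A basic neighbourhood restricts only finitely many coordinates; these are the
      points to interpolate.\<close>
    then obtain U where U: "finite {x. U x \<noteq> UNIV}" "\<phi> \<in> Pi\<^sub>E UNIV U" "Pi\<^sub>E UNIV U \<subseteq> W'"
      unfolding openin_product_topology_alt by fastforce
    obtain \<psi> where \<psi>: "\<psi> \<in> affine hull M" "\<forall>x\<in>{x. U x \<noteq> UNIV}. \<psi> x = \<phi> x"
      using interp[OF U(1)] by blast
    have "\<psi> x \<in> U x" for x
      using \<psi>(2) U(2) by (cases "U x = UNIV") (auto simp: PiE_iff)
    then have "\<psi> \<in> W'" using U(3) by (auto simp: PiE_iff)
    moreover have "\<psi> \<in> norm_dual u"
      using \<psi>(1) affine_hull_subset_span[of M] span_dual by blast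
    ultimately show "\<exists>\<psi>. \<psi> \<in> affine hull M \<and> \<psi> \<in> W" using W' \<psi> by blast
  qed
  with \<phi> show "\<phi> \<in> pure_states_closure u \<inter> weak_star u closure_of (affine hull M)" by blast
qed

section \<open>Bands and bisaturated annihilators\<close>

lemma subspace_zero_set:
  assumes "\<And>\<phi>. \<phi> \<in> M \<Longrightarrow> linear \<phi>"
  shows "subspace (zero_set M)"
  unfolding subspace_def zero_set_def using assms
  by (auto simp: linear_0 linear_add linear_scale)

theorem theorem16:
  fixes u :: "'a::ordered_real_vector" and B :: "'a set"
  assumes archimedean: "\<And>x y :: 'a. (\<forall>n::nat. real n *\<^sub>R x \<le> y) \<Longrightarrow> x \<le> 0"
    and unit: "order_unit u"
    and B: "B = zero_set (annihilator u B)"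
  shows "band B \<longleftrightarrow> bisaturated (weak_star u) (pure_states_closure u) (annihilator u B)"
proof -
  let ?V = "pure_states_closure u"
  define C where "C = disjoint_complement (disjoint_complement B)"
  have arch: "\<forall>x y :: 'a. (\<forall>n::nat. real n *\<^sub>R x \<le> y) \<longrightarrow> x \<le> 0"
    using archimedean by blast
  have C: "C = zero_set (?V - annihilator u (zero_set (?V - annihilator u B)))"
    unfolding C_def by (simp only: disjoint_complement_eq_zero_set[OF arch unit])
  have "subspace (zero_set (annihilator u B))"
    by (rule subspace_zero_set)
      (use pure_states_closure_state(1)[OF unit] in \<open>auto simp: annihilator_def\<close>)
  then have "subspace B" using B by simp
  then have "band B \<longleftrightarrow> C = B" by (simp add: band_def C_def)
  also have "\<dots> \<longleftrightarrow> annihilator u C = annihilator u B"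
  proof
    \<comment> \<open>\<open>C\<close> is the zero set of a subset of \<open>?V\<close>, so the
      Galois connection returns it; with the assumption on \<open>B\<close>, equal annihilators give
      equal sets.\<close>
    have "zero_set (annihilator u C) = C"
      unfolding C by (auto simp: zero_set_def annihilator_def)
    then show "C = B" if "annihilator u C = annihilator u B" using that B by simp
  qed simp
  \<comment> \<open>Both nested closed affine hulls, inner and outer, are traces of the form
    \<open>annihilator u (zero_set M)\<close> with \<open>M\<close> inside
    \<open>?V\<close>.\<close>
  also have "annihilator u C =
    ?V \<inter> weak_star u closure_of (affine hull
      (?V - ?V \<inter> weak_star u closure_of (affine hull (?V - annihilator u B))))"
    unfolding C by (simp add: closure_affine_hull_eq_annihilator[OF unit])
  also have "\<dots> = annihilator u B \<longleftrightarrow> bisaturated (weak_star u) ?V (annihilator u B)"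
    by (auto simp: bisaturated_def annihilator_def)
  finally show ?thesis .
qed

end
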